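(* Let $b,m$ be positive integers. Then, as an identity in the variables $x,y$, $$\sum_{\pi\in\mathrm{PF}(1,b,m)}x^{\#1(\pi)}y^{\mathrm{lel}(\pi)}=xy\Big[(m-1)b\,(x+y+mb-1)^{m-2}+(xy+b)(xy+mb)^{m-2}\Big].$$
   Context: $\mathrm{PF}(1,b,m)$ is the set of $(1,b)$-parking functions of length $m$: sequences $\pi=(\pi_1,\dots,\pi_m)$ of positive integers whose weakly increasing rearrangement $\lambda_1\le\cdots\le\lambda_m$ satisfies $\lambda_i\le 1+(i-1)b$ for $1\le i\le m$. Here $\#1(\pi)=\#\{k:\pi_k=1\}$ and $\mathrm{lel}(\pi)=\#\{k:\pi_k=\pi_1\}$. For $m=1$ (exponent $-1$) the right-hand side is read as a rational function. *)

theory Defs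
  imports Complex_Main "HOL-Computational_Algebra.Computational_Algebra"
begin

text \<open>
  \<open>(a,b)\<close>-parking functions of length \<open>m\<close>. Lists are indexed from 0, so \<open>\<lambda>\<^sub>i\<close> is
  \<open>sort \<pi> ! (i - 1)\<close>.
\<close>

definition PF :: "nat \<Rightarrow> nat \<Rightarrow> nat \<Rightarrow> nat list set" where
  "PF a b m = {\<pi>. length \<pi> = m \<and> (\<forall>k\<in>set \<pi>. 0 < k) \<and>
     (\<forall>i\<in>{1..m}. sort \<pi> ! (i - 1) \<le> a + (i - 1) * b)}"

definition ones :: "nat list \<Rightarrow> nat" where
  "ones \<pi> = card {k. k < length \<pi> \<and> \<pi> ! k = 1}"

definition lel :: "nat list \<Rightarrow> nat" where
  "lel \<pi> = card {k. k < length \<pi> \<and> \<pi> ! k = \<pi> ! 0}"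

text \<open>The sums over \<open>PF a b m\<close> below are sums over a finite set.\<close>

lemma finite_PF: "finite (PF a b m)"
proof -
  have "PF a b m \<subseteq> {\<pi>. set \<pi> \<subseteq> {..a + m * b} \<and> length \<pi> = m}"
  proof
    fix \<pi> assume p: "\<pi> \<in> PF a b m"
    have "x \<le> a + m * b" if "x \<in> set \<pi>" for x
    proof -
      from that have "x \<in> set (sort \<pi>)" by simp
      then obtain j where j: "j < length \<pi>" "x = sort \<pi> ! j"
        by (metis in_set_conv_nth length_sort)
      with p have "\<forall>i\<in>{1..m}. sort \<pi> ! (i - 1) \<le> a + (i - 1) * b" "j < m"
        by (auto simp: PF_def)
      then have "x \<le> a + j * b" using j(2) by (auto dest: bspec[where x = "Suc j"])
      also have "\<dots> \<le> a + m * b" using \<open>j < m\<close> by simp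
      finally show ?thesis .
    qed
    with p show "\<pi> \<in> {\<pi>. set \<pi> \<subseteq> {..a + m * b} \<and> length \<pi> = m}"
      by (auto simp: PF_def)
  qed
  then show ?thesis
    by (rule finite_subset) (rule finite_lists_length_eq, simp)
qed

text \<open>
  The indeterminates of the field of fractions of \<open>\<int>[x][y]\<close>, i.e. of \<open>\<rat>(x,y)\<close>:
  in \<^typ>\<open>int poly poly\<close> the inner variable is \<open>x\<close> and the outer one is \<open>y\<close>.
\<close>

definition X :: "int poly poly fract" where
  "X = to_fract [:[:0, 1:]:]"

definition Y :: "int poly poly fract" where
  "Y = to_fract [:0, 1:]"

end

theory Submission
  imports Defs
begin

text \<open>
  Everything follows from one recursion, which deletes the ones. A word \<open>\<pi>\<close> of positive
  integers is an \<open>(a,b)\<close>-parking function iff for every \<open>j\<close> below its length more than \<open>j\<close> of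
  its entries are at most \<open>a + j b\<close>. If \<open>\<pi>\<close> has \<open>s\<close> ones, then for \<open>a \<ge> 1\<close> deleting them and lowering all
  other entries by one turns this condition into the one for \<open>(a - 1 + s b, b)\<close>: the conditions
  with \<open>j < s\<close> hold because of the ones, and the others become those for \<open>j - s\<close>. The
  positions of the ones are arbitrary, so they contribute a binomial coefficient.

  Separate the first entry \<open>\<pi>\<^sub>1\<close> before doing so. If \<open>\<pi>\<^sub>1 = 1\<close>, then \<open>#1 = lel\<close>, so \<open>\<pi>\<close> has weight
  \<open>(x y)\<^sup>s\<close> and only the number of shorter parking functions matters. If \<open>\<pi>\<^sub>1 \<noteq> 1\<close>, then the
  deletion does not change \<open>lel\<close>, so \<open>\<pi>\<close> contributes \<open>x\<^sup>s\<close> times the \<open>y\<close>-weight of a shorter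
  parking function (lemma \<open>joint_sum_rec\<close>). The two cases produce the two summands of the
  identity.

  What remains is to know the sum at \<open>x = 1\<close>, which for parking functions of length \<open>n\<close> is
  \<open>a y (y + a + n b - 1)^(n - 1)\<close> (lemma \<open>joint_sum_at_1\<close>), and hence at \<open>x = y = 1\<close> the number
  of parking functions. Both come out of the same recursion by induction on the length and on
  \<open>a\<close>: in each term either the length or \<open>a\<close> has dropped. The reason why the sums close up is
  that \<open>a - 1 + s b\<close> plus \<open>b\<close> times the new length is \<open>a - 1 + n b\<close> for every \<open>s\<close>, so the base of
  the powers is constant and the binomial theorem applies (lemmas \<open>sum_choose_linear\<close> and
  \<open>sum_choose_pf_count\<close>).
\<close>

section \<open>Parking functions as a condition on counts\<close>

lemma sorted_nth_le_iff:
  fixes xs :: "'a::linorder list"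
  assumes "sorted xs" and "j < length xs"
  shows "xs ! j \<le> c \<longleftrightarrow> j < length (filter (\<lambda>k. k \<le> c) xs)"
  using assms
proof (induction xs arbitrary: j)
  case (Cons x xs)
  show ?case
  proof (cases j)
    case 0
    with Cons.prems show ?thesis
      by (auto simp: filter_empty_conv)
  next
    case (Suc i)
    show ?thesis
    proof (cases "x \<le> c")
      case False
      with Cons.prems have "\<forall>k\<in>set (x # xs). \<not> k \<le> c" by auto
      moreover from this Cons.prems(2) have "\<not> (x # xs) ! j \<le> c" by (meson nth_mem)
      ultimately show ?thesis by (simp add: filter_empty_conv[THEN iffD2])
    qed (use Cons Suc in auto)
  qed
qed simp

definition parks :: "nat \<Rightarrow> nat \<Rightarrow> nat list \<Rightarrow> bool" where
  "parks a b xs \<longleftrightarrow> (\<forall>j<length xs. j < length (filter (\<lambda>k. k \<le> a + j * b) xs))"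

lemma PF_eq_parks: "PF a b n = {xs. length xs = n \<and> 0 \<notin> set xs \<and> parks a b xs}"
proof -
  have "(\<forall>i\<in>{1..n}. sort xs ! (i - 1) \<le> a + (i - 1) * b) \<longleftrightarrow> parks a b xs"
    if "length xs = n" for xs
  proof -
    have "(\<forall>i\<in>{1..n}. sort xs ! (i - 1) \<le> a + (i - 1) * b) \<longleftrightarrow>
          (\<forall>j<n. sort xs ! j \<le> a + j * b)"
    proof (intro iffI allI impI ballI)
      fix j assume "\<forall>i\<in>{1..n}. sort xs ! (i - 1) \<le> a + (i - 1) * b" and "j < n"
      then show "sort xs ! j \<le> a + j * b" by (auto dest: bspec[of _ _ "Suc j"])
    qed auto
    also have "\<dots> \<longleftrightarrow> parks a b xs"
      using that by (auto simp: parks_def sorted_nth_le_iff filter_sort)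
    finally show ?thesis .
  qed
  moreover have "(\<forall>k\<in>set xs. 0 < k) \<longleftrightarrow> 0 \<notin> set xs" for xs :: "nat list"
    by (metis gr0I less_irrefl)
  ultimately show ?thesis
    unfolding PF_def by blast
qed

text \<open>
  The heart of the recursion. With \<open>s\<close> ones, the number of entries of \<open>xs\<close> that are at most
  \<open>t + 1\<close> is \<open>s\<close> plus the number of entries of \<open>ys\<close> that are at most \<open>t\<close>. Hence the condition at
  \<open>j < s\<close> is automatic and the condition at \<open>j = s + i\<close> is the one at \<open>i\<close> for \<open>ys\<close>.
\<close>

lemma parks_remove_ones:
  assumes "0 \<notin> set xs" and ys: "removeAll 1 xs = map Suc ys"
  shows "parks (Suc c) b xs \<longleftrightarrow> parks (c + count_list xs 1 * b) b ys"
proof -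
  define s where "s = count_list xs 1"
  have cnt: "length (filter (\<lambda>k. k \<le> Suc t) xs) = s + length (filter (\<lambda>k. k \<le> t) ys)" for t
  proof -
    have "length (filter (\<lambda>k. k \<le> Suc t) xs) =
          count_list xs 1 + length (filter (\<lambda>k. k \<le> Suc t) (removeAll 1 xs))"
      by (induction xs) auto
    then show ?thesis by (simp add: ys[unfolded One_nat_def] s_def filter_map o_def)
  qed
  have len: "length xs = s + length ys"
  proof -
    have "length xs = count_list xs 1 + length (removeAll 1 xs)"
      by (induction xs) auto
    then show ?thesis by (simp add: ys[unfolded One_nat_def] s_def)
  qed
  have "parks (Suc c) b xs \<longleftrightarrow>
        (\<forall>j<s + length ys. j < s + length (filter (\<lambda>k. k \<le> c + j * b) ys))"
    by (simp add: parks_def len cnt)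
  also have "\<dots> \<longleftrightarrow>
        (\<forall>i<length ys. s + i < s + length (filter (\<lambda>k. k \<le> c + (s + i) * b) ys))"
  proof (intro iffI allI impI)
    fix i assume "\<forall>j<s + length ys. j < s + length (filter (\<lambda>k. k \<le> c + j * b) ys)"
      and "i < length ys"
    then show "s + i < s + length (filter (\<lambda>k. k \<le> c + (s + i) * b) ys)"
      by (auto dest: spec[of _ "s + i"])
  next
    fix j assume *: "\<forall>i<length ys. s + i < s + length (filter (\<lambda>k. k \<le> c + (s + i) * b) ys)"
      and "j < s + length ys"
    then show "j < s + length (filter (\<lambda>k. k \<le> c + j * b) ys)"
      using spec[OF *, of "j - s"] by (cases "j < s") auto
  qed
  also have "\<dots> \<longleftrightarrow> parks (c + s * b) b ys"
    by (simp add: parks_def algebra_simps)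
  finally show ?thesis by (simp add: s_def)
qed

section \<open>Sums over words\<close>

definition words :: "nat \<Rightarrow> 'a set \<Rightarrow> 'a list set" where
  "words n A = {xs. set xs \<subseteq> A \<and> length xs = n}"

lemma words_0 [simp]: "words 0 A = {[]}"
  by (auto simp: words_def)

lemma sum_words_Suc:
  "(\<Sum>xs\<in>words (Suc n) A. f xs) = (\<Sum>z\<in>A. \<Sum>xs\<in>words n A. f (z # xs))"
proof -
  have "words (Suc n) A = (\<lambda>(z, xs). z # xs) ` (A \<times> words n A)"
    by (auto simp: words_def length_Suc_conv image_iff)
  moreover have "inj_on (\<lambda>(z, xs). z # xs) (A \<times> words n A)"
    by (auto simp: inj_on_def)
  ultimately show ?thesis
    by (simp add: sum.reindex sum.cartesian_product case_prod_unfold)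
qed

lemma sum_words_image:
  fixes g :: "'a \<Rightarrow> 'c"
  assumes "inj g"
  shows "(\<Sum>xs\<in>words n (g ` A). f xs) = (\<Sum>xs\<in>words n A. f (map g xs))"
proof -
  have "words n B = lists B \<inter> {xs. length xs = n}" for B :: "'c set"
    by (auto simp: words_def)
  moreover have "words n A = lists A \<inter> {xs. length xs = n}"
    by (auto simp: words_def)
  ultimately have "words n (g ` A) = map g ` words n A"
    by (auto simp: lists_image)
  moreover have "inj_on (map g) (words n A)"
    using assms by (auto intro: inj_on_subset[OF inj_mapI])
  ultimately show ?thesis by (simp add: sum.reindex)
qed

text \<open>
  A word over \<open>A \<union> {z}\<close> is a set of positions for the letter \<open>z\<close> together with the word over \<open>A\<close>
  on the other positions. Letting the summand \<open>h\<close> be arbitrary makes the induction on the length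
  possible: the first letter can be absorbed into \<open>h\<close>, and the two cases for it combine by
  Pascal's rule.
\<close>

lemma sum_words_insert:
  fixes h :: "nat \<Rightarrow> 'a list \<Rightarrow> 'b::comm_semiring_1"
  assumes "finite A" and "z \<notin> A"
  shows "(\<Sum>xs\<in>words n (insert z A). h (count_list xs z) (removeAll z xs)) =
         (\<Sum>s\<le>n. of_nat (n choose s) * (\<Sum>ys\<in>words (n - s) A. h s ys))"
proof (induction n arbitrary: h)
  case (Suc n)
  define S where "S s = (\<Sum>ys\<in>words (Suc n - s) A. h s ys)" for s
  have "(\<Sum>xs\<in>words (Suc n) (insert z A). h (count_list xs z) (removeAll z xs)) =
      (\<Sum>xs\<in>words n (insert z A). h (Suc (count_list xs z)) (removeAll z xs)) +
      (\<Sum>w\<in>A. \<Sum>xs\<in>words n (insert z A). h (count_list xs z) (w # removeAll z xs))"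
  proof -
    have "(\<Sum>w\<in>A. \<Sum>xs\<in>words n (insert z A).
          h (count_list (w # xs) z) (removeAll z (w # xs))) =
        (\<Sum>w\<in>A. \<Sum>xs\<in>words n (insert z A). h (count_list xs z) (w # removeAll z xs))"
      by (intro sum.cong refl) (use assms in auto)
    then show ?thesis
      unfolding sum_words_Suc sum.insert[OF assms] by simp
  qed
  also have "(\<Sum>xs\<in>words n (insert z A). h (Suc (count_list xs z)) (removeAll z xs)) =
      (\<Sum>s\<le>n. of_nat (n choose s) * S (Suc s))"
    unfolding S_def using Suc.IH[of "\<lambda>s. h (Suc s)"] by simp
  also have "(\<Sum>w\<in>A. \<Sum>xs\<in>words n (insert z A). h (count_list xs z) (w # removeAll z xs)) =
      (\<Sum>s\<le>n. of_nat (n choose s) * S s)"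
  proof -
    have "(\<Sum>w\<in>A. \<Sum>xs\<in>words n (insert z A). h (count_list xs z) (w # removeAll z xs)) =
        (\<Sum>w\<in>A. \<Sum>s\<le>n. of_nat (n choose s) * (\<Sum>ys\<in>words (n - s) A. h s (w # ys)))"
      using Suc.IH[of "\<lambda>s ys. h s (_ # ys)"] by (intro sum.cong) auto
    also have "\<dots> = (\<Sum>s\<le>n. of_nat (n choose s) * S s)"
      unfolding S_def
      by (subst sum.swap) (auto simp: Suc_diff_le sum_words_Suc sum_distrib_left intro!: sum.cong)
    finally show ?thesis .
  qed
  also have "(\<Sum>s\<le>n. of_nat (n choose s) * S (Suc s)) + (\<Sum>s\<le>n. of_nat (n choose s) * S s) =
      (\<Sum>s\<le>Suc n. of_nat (Suc n choose s) * S s)"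
  proof -
    have "(\<Sum>s\<le>n. of_nat (n choose s) * S s) = (\<Sum>s\<le>Suc n. of_nat (n choose s) * S s)"
      by (simp add: binomial_eq_0)
    also have "\<dots> = S 0 + (\<Sum>s\<le>n. of_nat (n choose Suc s) * S (Suc s))"
      by (subst sum.atMost_Suc_shift) simp
    finally have "(\<Sum>s\<le>n. of_nat (n choose s) * S s) = \<dots>" .
    moreover have "(\<Sum>s\<le>Suc n. of_nat (Suc n choose s) * S s) =
        S 0 + (\<Sum>s\<le>n. of_nat (Suc n choose Suc s) * S (Suc s))"
      by (subst sum.atMost_Suc_shift) simp
    ultimately show ?thesis
      by (simp add: sum.distrib algebra_simps)
  qed
  finally show ?case by (simp add: S_def)
qed simp

text \<open>
  Parking functions of different parameters can be summed over words on a common alphabet, since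
  the parking condition at the last index bounds all the entries.
\<close>

lemma sum_PF_eq_words:
  assumes "a + n * b \<le> M"
  shows "(\<Sum>xs\<in>PF a b n. f xs) =
         (\<Sum>xs\<in>words n {1..M}. if parks a b xs then f xs else 0)"
proof -
  have bound: "k \<le> M" if "parks a b xs" "length xs = n" "k \<in> set xs" for xs k
  proof -
    have n: "n - 1 < n" using that by (cases n) auto
    with that have "n - 1 < length (filter (\<lambda>k. k \<le> a + (n - 1) * b) xs)"
      by (simp add: parks_def)
    with that n have "length (filter (\<lambda>k. k \<le> a + (n - 1) * b) xs) = length xs"
      using length_filter_le[of "\<lambda>k. k \<le> a + (n - 1) * b" xs] by linarith
    with that have "k \<le> a + (n - 1) * b"
      by (metis length_filter_less order_less_irrefl)
    also have "\<dots> \<le> a + n * b" by simp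
    finally show ?thesis using assms by simp
  qed
  have "PF a b n = {xs \<in> words n {1..M}. parks a b xs}"
  proof (intro set_eqI iffI)
    fix xs assume "xs \<in> PF a b n"
    then have xs: "length xs = n" "0 \<notin> set xs" "parks a b xs" by (auto simp: PF_eq_parks)
    then have "1 \<le> k \<and> k \<le> M" if "k \<in> set xs" for k
      using that bound[of xs k] by (cases k) auto
    with xs show "xs \<in> {xs \<in> words n {1..M}. parks a b xs}" by (auto simp: words_def)
  qed (auto simp: PF_eq_parks words_def)
  moreover have "finite (words n {1..M})"
    unfolding words_def by (rule finite_lists_length_eq) simp
  ultimately show ?thesis by (simp add: sum.inter_filter)
qed

section \<open>The recursion that removes the ones\<close>

lemma ones_eq_count_list: "ones \<pi> = count_list \<pi> 1"
  unfolding ones_def count_list_eq_length_filter length_filter_conv_card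
  by (rule arg_cong[where f = card]) auto

lemma lel_Cons: "lel (z # \<pi>) = Suc (count_list \<pi> z)"
proof -
  have "lel (z # \<pi>) = count_list (z # \<pi>) z"
    unfolding lel_def count_list_eq_length_filter length_filter_conv_card
    by (rule arg_cong[where f = card]) auto
  then show ?thesis by simp
qed

definition joint_sum :: "nat \<Rightarrow> nat \<Rightarrow> nat \<Rightarrow> 'a::comm_ring_1 \<Rightarrow> 'a \<Rightarrow> 'a" where
  "joint_sum a b n x y = (\<Sum>\<pi>\<in>PF a b n. x ^ ones \<pi> * y ^ lel \<pi>)"

text \<open>
  The first sum comes from the parking functions with first entry 1, where \<open>s\<close> counts the further
  ones. The second comes from those with another first entry, where \<open>s\<close> counts all the ones and
  the first entry survives their removal; the weight \<open>1\<close> in place of \<open>x\<close> is there because the ones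
  of the shorter word, which were twos before, are not counted.
\<close>

lemma joint_sum_rec:
  "joint_sum (Suc c) b (Suc n) x y =
     (\<Sum>s\<le>n. of_nat (n choose s) * (x * y) ^ Suc s *
        of_nat (card (PF (c + Suc s * b) b (n - s)))) +
     (\<Sum>s\<le>n. of_nat (n choose s) * x ^ s * joint_sum (c + s * b) b (Suc n - s) 1 y)"
proof -
  \<comment> \<open>All shorter parking functions that occur, too, have their entries in \<open>{1..M}\<close>.\<close>
  define M where "M = c + Suc n * b"
  define A where "A = Suc ` {1..M}"
  have letters: "{1..Suc M} = insert 1 A"
    by (auto simp: A_def image_iff)
  have A: "finite A" "1 \<notin> A" "0 \<notin> A" by (auto simp: A_def)
  define p :: "nat list \<Rightarrow> nat list" where "p = map (\<lambda>k. k - 1)"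
  have p_Suc: "p (map Suc ys) = ys" for ys
    by (simp add: p_def o_def)
  have parks_iff: "parks (Suc c) b xs \<longleftrightarrow> parks (c + count_list xs 1 * b) b (p (removeAll 1 xs))"
    if "set xs \<subseteq> insert 1 A" for xs
  proof (rule parks_remove_ones)
    show "0 \<notin> set xs" using that A by auto
    have "removeAll 1 xs = map (\<lambda>k. Suc (k - 1)) (removeAll 1 xs)"
      using that A by (intro map_idI[symmetric]) (auto simp: A_def)
    then show "removeAll 1 xs = map Suc (p (removeAll 1 xs))"
      by (simp add: p_def o_def)
  qed
  define f :: "nat list \<Rightarrow> 'a" where
    "f xs = (if parks (Suc c) b xs then x ^ ones xs * y ^ lel xs else 0)" for xs
  have "joint_sum (Suc c) b (Suc n) x y = (\<Sum>xs\<in>words (Suc n) (insert 1 A). f xs)"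
    unfolding joint_sum_def f_def letters[symmetric]
    by (rule sum_PF_eq_words) (simp add: M_def)
  also have "\<dots> = (\<Sum>xs\<in>words n (insert 1 A). f (1 # xs)) +
      (\<Sum>z\<in>A. \<Sum>xs\<in>words n (insert 1 A). f (z # xs))"
    using A by (simp add: sum_words_Suc)
  also have "(\<Sum>xs\<in>words n (insert 1 A). f (1 # xs)) =
      (\<Sum>s\<le>n. of_nat (n choose s) * (x * y) ^ Suc s *
        of_nat (card (PF (c + Suc s * b) b (n - s))))"
  proof -
    define h :: "nat \<Rightarrow> nat list \<Rightarrow> 'a" where
      "h s ys = (if parks (c + Suc s * b) b (p ys) then (x * y) ^ Suc s else 0)" for s ys
    have "(\<Sum>xs\<in>words n (insert 1 A). f (1 # xs)) =
        (\<Sum>xs\<in>words n (insert 1 A). h (count_list xs 1) (removeAll 1 xs))"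
    proof (rule sum.cong)
      fix xs assume "xs \<in> words n (insert 1 A)"
      then show "f (1 # xs) = h (count_list xs 1) (removeAll 1 xs)"
        using parks_iff[of "1 # xs"]
        by (simp add: f_def h_def words_def ones_eq_count_list lel_Cons power_mult_distrib)
    qed simp
    also have "\<dots> = (\<Sum>s\<le>n. of_nat (n choose s) * (\<Sum>ys\<in>words (n - s) A. h s ys))"
      by (rule sum_words_insert) (use A in auto)
    also have "(\<Sum>ys\<in>words (n - s) A. h s ys) =
        (x * y) ^ Suc s * of_nat (card (PF (c + Suc s * b) b (n - s)))" if "s \<le> n" for s
    proof -
      have "c + Suc s * b + (n - s) * b \<le> M"
        using that by (simp add: M_def flip: add_mult_distrib)
      from sum_PF_eq_words[OF this, of "\<lambda>_. (x * y) ^ Suc s"] show ?thesis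
        unfolding A_def sum_words_image[OF inj_Suc] h_def p_Suc by (simp add: mult.commute)
    qed
    ultimately show ?thesis by (simp add: mult.assoc)
  qed
  also have "(\<Sum>z\<in>A. \<Sum>xs\<in>words n (insert 1 A). f (z # xs)) =
      (\<Sum>s\<le>n. of_nat (n choose s) * x ^ s * joint_sum (c + s * b) b (Suc n - s) 1 y)"
  proof -
    define h :: "nat \<Rightarrow> nat list \<Rightarrow> 'a" where
      "h s ys = (if parks (c + s * b) b (p ys) then x ^ s * y ^ lel (p ys) else 0)" for s ys
    have "(\<Sum>z\<in>A. \<Sum>xs\<in>words n (insert 1 A). f (z # xs)) =
        (\<Sum>z\<in>A. \<Sum>xs\<in>words n (insert 1 A). h (count_list xs 1) (z # removeAll 1 xs))"
    proof (intro sum.cong refl)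
      fix z xs assume z: "z \<in> A" and xs: "xs \<in> words n (insert 1 A)"
      then have z1: "z \<noteq> 1" and sub: "set xs \<subseteq> insert 1 A" using A by (auto simp: words_def)
      have "count_list (p (removeAll 1 xs)) (z - 1) = count_list xs z"
        using sub z A by (induction xs) (auto simp: p_def A_def)
      then have "lel (p (z # removeAll 1 xs)) = lel (z # xs)"
        by (simp add: p_def lel_Cons)
      then show "f (z # xs) = h (count_list xs 1) (z # removeAll 1 xs)"
        using parks_iff[of "z # xs"] z z1 sub
        by (simp add: f_def h_def ones_eq_count_list)
    qed
    also have "\<dots> = (\<Sum>z\<in>A. \<Sum>s\<le>n. of_nat (n choose s) * (\<Sum>ys\<in>words (n - s) A. h s (z # ys)))"
      using A by (intro sum.cong refl sum_words_insert)
    also have "\<dots> = (\<Sum>s\<le>n. of_nat (n choose s) * (\<Sum>ys\<in>words (Suc n - s) A. h s ys))"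
      by (subst sum.swap) (auto simp: Suc_diff_le sum_words_Suc sum_distrib_left intro!: sum.cong)
    also have "(\<Sum>ys\<in>words (Suc n - s) A. h s ys) =
        x ^ s * joint_sum (c + s * b) b (Suc n - s) 1 y" if "s \<le> n" for s
    proof -
      have "c + s * b + (Suc n - s) * b \<le> M"
        using that by (simp add: M_def flip: add_mult_distrib)
      from sum_PF_eq_words[OF this, of "\<lambda>\<pi>. x ^ s * y ^ lel \<pi>"] show ?thesis
        unfolding A_def sum_words_image[OF inj_Suc] h_def p_Suc
        by (simp add: joint_sum_def sum_distrib_left)
    qed
    ultimately show ?thesis by (simp add: mult.assoc)
  qed
  finally show ?thesis .
qed

section \<open>Two binomial sums\<close>

lemma sum_choose_linear:
  fixes x u v w :: "'a::comm_ring_1"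
  shows "(\<Sum>s\<le>n. of_nat (n choose s) * x ^ s * ((v + of_nat s * w) * u ^ (n - s))) =
    v * (x + u) ^ n + of_nat n * w * x * (x + u) ^ (n - 1)"
proof -
  have "(\<Sum>s\<le>n. of_nat (n choose s) * x ^ s * ((v + of_nat s * w) * u ^ (n - s))) =
      v * (\<Sum>s\<le>n. of_nat (n choose s) * x ^ s * u ^ (n - s)) +
      w * (\<Sum>s\<le>n. of_nat (s * (n choose s)) * x ^ s * u ^ (n - s))"
    by (simp add: sum_distrib_left algebra_simps flip: sum.distrib)
  also have "(\<Sum>s\<le>n. of_nat (s * (n choose s)) * x ^ s * u ^ (n - s)) =
      of_nat n * x * (x + u) ^ (n - 1)"
  proof (cases n)
    case (Suc m)
    have "(\<Sum>s\<le>n. of_nat (s * (n choose s)) * x ^ s * u ^ (n - s)) =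
        (\<Sum>s\<le>m. of_nat (Suc s * (Suc m choose Suc s)) * x ^ Suc s * u ^ (m - s))"
      unfolding Suc by (subst sum.atMost_Suc_shift) simp
    also have "\<dots> = of_nat n * x * (\<Sum>s\<le>m. of_nat (m choose s) * x ^ s * u ^ (m - s))"
      unfolding Suc_times_binomial Suc by (simp add: sum_distrib_left mult_ac del: of_nat_Suc mult_Suc)
    finally show ?thesis by (simp add: binomial_ring Suc)
  qed simp
  finally show ?thesis
    unfolding binomial_ring[of x u n, symmetric] by (simp add: mult_ac)
qed

text \<open>
  The number of parking functions, as \<open>card_PF\<close> shows. At \<open>n = 0\<close> the general formula means
  \<open>a / a = 1\<close>, whereas truncated subtraction would make it \<open>a\<close>.
\<close>

definition pf_count :: "nat \<Rightarrow> nat \<Rightarrow> nat \<Rightarrow> nat" where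
  "pf_count a b n = (if n = 0 then 1 else a * (a + n * b) ^ (n - 1))"

text \<open>
  The linear factor of \<open>pf_count\<close> differs from the base \<open>u\<close> of its power by a multiple of \<open>n - s\<close>.
  So each term is a difference \<open>u^(n-s) - (n-s) b u^(n-s-1)\<close>, which also gives the value 1 at
  \<open>s = n\<close>, and \<open>n - s\<close> is absorbed by the binomial coefficient. This form avoids a division
  by \<open>u\<close>, so that the identity holds in every commutative ring.
\<close>

lemma sum_choose_pf_count:
  fixes t :: "'a::comm_ring_1"
  shows "(\<Sum>s\<le>n. of_nat (n choose s) * t ^ s * of_nat (pf_count (c + s * b) b (n - s))) =
    (if n = 0 then 1 else (of_nat c + t) * (t + of_nat (c + n * b)) ^ (n - 1))"
proof (cases n)
  case (Suc m)
  define u :: 'a where "u = of_nat (c + n * b)"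
  have count: "of_nat (pf_count (c + s * b) b (n - s)) =
      (u ^ (n - s) - of_nat ((n - s) * b) * u ^ (n - s - 1) :: 'a)" if "s \<le> n" for s
  proof (cases "s = n")
    case False
    with that have "n - s = Suc (n - s - 1)" by simp
    then have pow: "u ^ (n - s) = u * u ^ (n - s - 1)" by (metis power_Suc)
    have "c + n * b = c + s * b + (n - s) * b"
      using that by (simp flip: add_mult_distrib)
    then have u: "u = of_nat (c + s * b + (n - s) * b)"
      by (simp only: u_def)
    have "of_nat (pf_count (c + s * b) b (n - s)) = (of_nat (c + s * b) * u ^ (n - s - 1) :: 'a)"
      using False that unfolding pf_count_def u by simp
    also have "of_nat (c + s * b) = (u - of_nat ((n - s) * b) :: 'a)"
      unfolding u of_nat_add by (rule add_diff_cancel_right'[symmetric])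
    finally show ?thesis by (simp add: pow algebra_simps)
  qed (simp add: pf_count_def)
  have "(\<Sum>s\<le>n. of_nat (n choose s) * t ^ s * of_nat (pf_count (c + s * b) b (n - s))) =
      (\<Sum>s\<le>n. of_nat (n choose s) * t ^ s * u ^ (n - s)) -
      (\<Sum>s\<le>n. of_nat ((n - s) * (n choose s)) * of_nat b * t ^ s * u ^ (n - s - 1))"
    by (simp add: count algebra_simps flip: sum_subtractf)
  also have "(\<Sum>s\<le>n. of_nat ((n - s) * (n choose s)) * of_nat b * t ^ s * u ^ (n - s - 1)) =
      (\<Sum>s\<le>m. of_nat ((n - s) * (n choose s)) * of_nat b * t ^ s * u ^ (m - s))"
    by (simp add: Suc diff_right_commute)
  also have "\<dots> = of_nat (n * b) * (\<Sum>s\<le>m. of_nat (m choose s) * t ^ s * u ^ (m - s))"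
  proof -
    have "(n - s) * (n choose s) = n * (m choose s)" for s
      using binomial_absorb_comp[of n s] by (simp add: Suc)
    then show ?thesis
      by (simp add: sum_distrib_left mult_ac del: of_nat_mult) (simp add: mult_ac)
  qed
  also have "\<dots> = of_nat (n * b) * (t + u) ^ m"
    by (simp add: binomial_ring)
  also have "(\<Sum>s\<le>n. of_nat (n choose s) * t ^ s * u ^ (n - s)) = (t + u) * (t + u) ^ m"
    using binomial_ring[of t u n] by (simp add: Suc)
  finally show ?thesis
    by (simp add: Suc u_def algebra_simps)
qed (simp add: pf_count_def)

section \<open>Evaluation of the sum\<close>

text \<open>
  One application of the recursion, given the values of the terms on its right-hand side. It
  serves twice: inside the induction, at \<open>x = 1\<close>, and after it, for all \<open>x\<close>.
\<close>

lemma joint_sum_step: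
  fixes x y :: "'a::comm_ring_1"
  assumes count: "\<And>s. s \<le> n \<Longrightarrow>
      of_nat (card (PF (c + Suc s * b) b (n - s))) =
      (of_nat (pf_count (c + Suc s * b) b (n - s)) :: 'a)"
    and at_1: "\<And>s. s \<le> n \<Longrightarrow>
      joint_sum (c + s * b) b (Suc (n - s)) 1 y =
      of_nat (c + s * b) * y * (y + of_nat (c + Suc n * b) - 1) ^ (n - s)"
  shows "joint_sum (Suc c) b (Suc n) x y =
    x * y * (if n = 0 then 1
      else (of_nat (c + b) + x * y) * (x * y + of_nat (c + Suc n * b)) ^ (n - 1)) +
    y * (of_nat c * (x + y + of_nat (c + Suc n * b) - 1) ^ n +
      of_nat (n * b) * x * (x + y + of_nat (c + Suc n * b) - 1) ^ (n - 1))"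
proof -
  have "(\<Sum>s\<le>n. of_nat (n choose s) * (x * y) ^ Suc s *
        of_nat (card (PF (c + Suc s * b) b (n - s)))) =
      x * y * (\<Sum>s\<le>n. of_nat (n choose s) * (x * y) ^ s *
        of_nat (pf_count ((c + b) + s * b) b (n - s)))"
    unfolding sum_distrib_left
    by (intro sum.cong refl) (use count in \<open>simp add: mult_ac add.assoc del: of_nat_Suc\<close>)
  also have "\<dots> = x * y * (if n = 0 then 1
      else (of_nat (c + b) + x * y) * (x * y + of_nat (c + Suc n * b)) ^ (n - 1))"
    unfolding sum_choose_pf_count by (simp add: add_ac)
  finally have one: "(\<Sum>s\<le>n. of_nat (n choose s) * (x * y) ^ Suc s *
        of_nat (card (PF (c + Suc s * b) b (n - s)))) = \<dots>" .
  define u where "u = y + of_nat (c + Suc n * b) - 1"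
  have "(\<Sum>s\<le>n. of_nat (n choose s) * x ^ s * joint_sum (c + s * b) b (Suc n - s) 1 y) =
      y * (\<Sum>s\<le>n. of_nat (n choose s) * x ^ s *
        ((of_nat c + of_nat s * of_nat b) * u ^ (n - s)))"
    unfolding sum_distrib_left
    by (intro sum.cong refl) (simp add: Suc_diff_le at_1 u_def mult_ac del: of_nat_Suc mult_Suc)
  also have "\<dots> = y * (of_nat c * (x + u) ^ n + of_nat (n * b) * x * (x + u) ^ (n - 1))"
    unfolding sum_choose_linear by simp
  also have "x + u = x + y + of_nat (c + Suc n * b) - 1"
    by (simp add: u_def)
  finally show ?thesis
    unfolding joint_sum_rec one by simp
qed

lemma of_nat_card_PF: "of_nat (card (PF a b n)) = joint_sum a b n 1 (1 :: 'a::comm_ring_1)"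
  by (simp add: joint_sum_def)

lemma PF_0_left: "PF 0 b (Suc n) = {}"
proof -
  have False if "length xs = Suc n" "0 \<notin> set xs" "parks 0 b xs" for xs
  proof -
    from that have "0 < length (filter (\<lambda>k. k \<le> 0 + 0 * b) xs)"
      unfolding parks_def by (metis zero_less_Suc)
    with that(2) show False by (auto simp: filter_empty_conv)
  qed
  then show ?thesis by (auto simp: PF_eq_parks)
qed

lemma PF_length_0: "PF a b 0 = {[]}"
  by (auto simp: PF_eq_parks parks_def)

text \<open>
  Induction on the length, and on \<open>a\<close> within it. In the recursion only the term \<open>s = 0\<close> of the
  second sum keeps the length, and it has a smaller \<open>a\<close>. The numbers of shorter parking functions
  are the case \<open>y = 1\<close> of the induction hypothesis, which therefore has to cover all \<open>y\<close>.
\<close>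

lemma joint_sum_at_1:
  fixes y :: "'a::comm_ring_1"
  shows "joint_sum a b (Suc n) 1 y = of_nat a * y * (y + of_nat (a + Suc n * b) - 1) ^ n"
proof (induction n arbitrary: a y rule: less_induct)
  case (less n)
  have count: "of_nat (card (PF a' b n')) = (of_nat (pf_count a' b n') :: 'a)"
    if "n' \<le> n" for a' n'
  proof (cases n')
    case (Suc k)
    with that less.IH[of k a' 1] show ?thesis
      by (simp add: of_nat_card_PF pf_count_def)
  qed (simp add: PF_length_0 pf_count_def)
  show ?case
  proof (induction a)
    case 0
    show ?case by (simp add: joint_sum_def PF_0_left)
  next
    case (Suc c)
    have "joint_sum (c + s * b) b (Suc (n - s)) 1 y =
      of_nat (c + s * b) * y * (y + of_nat (c + Suc n * b) - 1) ^ (n - s)" if "s \<le> n" for s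
    proof (cases "s = 0")
      case False
      have "c + s * b + Suc (n - s) * b = c + Suc n * b"
        using that by (simp flip: add_mult_distrib)
      from less.IH[of "n - s" "c + s * b" y, unfolded this] False that show ?thesis by simp
    qed (use Suc.IH in simp)
    from joint_sum_step[OF count this, where x = 1]
    have "joint_sum (Suc c) b (Suc n) 1 y =
        y * (if n = 0 then 1
          else (of_nat (c + b) + y) * (y + of_nat (c + Suc n * b)) ^ (n - 1)) +
        y * (of_nat c * (y + of_nat (c + Suc n * b)) ^ n +
          of_nat (n * b) * (y + of_nat (c + Suc n * b)) ^ (n - 1))"
      by (simp add: algebra_simps)
    also have "\<dots> = of_nat (Suc c) * y * (y + of_nat (c + Suc n * b)) ^ n"
      by (cases n) (simp_all add: algebra_simps)
    finally show ?case by (simp add: algebra_simps)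
  qed
qed

lemma card_PF: "card (PF a b n) = pf_count a b n"
proof (cases n)
  case (Suc k)
  have "int (card (PF a b n)) = int (pf_count a b n)"
    using joint_sum_at_1[of a b k "1 :: int"] by (simp add: of_nat_card_PF Suc pf_count_def)
  then show ?thesis by simp
qed (simp add: PF_length_0 pf_count_def)

lemma joint_sum_eq:
  fixes x y :: "'a::comm_ring_1"
  shows "joint_sum (Suc c) b (Suc n) x y =
    x * y * (if n = 0 then 1
      else (of_nat (c + b) + x * y) * (x * y + of_nat (c + Suc n * b)) ^ (n - 1)) +
    y * (of_nat c * (x + y + of_nat (c + Suc n * b) - 1) ^ n +
      of_nat (n * b) * x * (x + y + of_nat (c + Suc n * b) - 1) ^ (n - 1))"
proof (rule joint_sum_step)
  fix s assume "s \<le> n"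
  then have "c + s * b + Suc (n - s) * b = c + Suc n * b"
    by (simp flip: add_mult_distrib)
  from joint_sum_at_1[of "c + s * b" b "n - s" y, unfolded this]
  show "joint_sum (c + s * b) b (Suc (n - s)) 1 y =
      of_nat (c + s * b) * y * (y + of_nat (c + Suc n * b) - 1) ^ (n - s)" .
qed (simp add: card_PF)

text \<open>
  This makes the exponent \<open>-1\<close> meaningful for parking functions of length 1: the factor
  \<open>X Y + b\<close> cancels.
\<close>

lemma XY_plus_of_nat_neq_0: "X * Y + of_nat b \<noteq> 0"
proof -
  have "of_nat b = to_fract (of_nat b :: int poly poly)"
    by (induction b) simp_all
  then have "X * Y + of_nat b = to_fract ([:[:0, 1:]:] * [:0, 1:] + of_nat b)"
    unfolding X_def Y_def by (simp only: to_fract_add to_fract_mult)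
  moreover have "coeff ([:[:0, 1:]:] * [:0, 1:] + of_nat b :: int poly poly) 1 = [:0, 1:]"
    by (simp add: of_nat_poly)
  then have "[:[:0, 1:]:] * [:0, 1:] + of_nat b \<noteq> (0 :: int poly poly)"
    by (metis coeff_0 pCons_eq_0_iff zero_neq_one)
  ultimately show ?thesis
    by (metis to_fract_eq_0_iff)
qed

theorem corollary7p6:
  fixes b m :: nat
  assumes "0 < b" and "0 < m"
  shows "(\<Sum>\<pi>\<in>PF 1 b m. X ^ ones \<pi> * Y ^ lel \<pi>) =
    X * Y *
      ((of_nat m - 1) * of_nat b * (X + Y + of_nat m * of_nat b - 1) powi (int m - 2) +
       (X * Y + of_nat b) * (X * Y + of_nat m * of_nat b) powi (int m - 2))"
proof -
  obtain n where m: "m = Suc n" using assms(2) by (cases m) auto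
  have sum: "(\<Sum>\<pi>\<in>PF 1 b m. X ^ ones \<pi> * Y ^ lel \<pi>) = joint_sum (Suc 0) b (Suc n) X Y"
    by (simp add: joint_sum_def m)
  show ?thesis
  proof (cases n)
    case 0
    then show ?thesis
      unfolding sum joint_sum_eq using XY_plus_of_nat_neq_0[of b]
      by (simp add: m power_int_minus)
  next
    case (Suc k)
    have "z powi (int m - 2) = z ^ k" for z :: "int poly poly fract"
      using Suc m by simp
    then show ?thesis
      unfolding sum joint_sum_eq by (simp add: m Suc algebra_simps)
  qed
qed

end
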